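(* Let $n\ge 1$, let $\Phi$ be the irreducible root system of type $A_n$, let $W=S_{n+1}$, and let $X_{n+1}=\{1,2,\dots,n+1\}$. There exists a $W$-equivariant bijection between the set of all biclosed sets in $\Phi$ and the set of all quasitrivial semigroup structures on $X_{n+1}$.
   Context: Root system of type $A_n$: let $V$ be a real vector space with basis $\alpha_1,\dots,\alpha_n$ and $\Phi=\{\pm(\alpha_i+\alpha_{i+1}+\cdots+\alpha_k): 1\le i\le k\le n\}$. For $1\le j\le k\le n$ write $\alpha_{j,k+1}=\alpha_j+\alpha_{j+1}+\cdots+\alpha_k$ and $\alpha_{k+1,j}=-\alpha_{j,k+1}$. The group $W=S_{n+1}$ acts on $\Phi$ (via the reflection representation) by $w(\alpha_{a,b})=\alpha_{w(a),w(b)}$ for $a\ne b$ in $\{1,\dots,n+1\}$. A subset $C\subset\Phi$ is closed if $\alpha,\beta\in C$ and $\alpha+\beta\in\Phi$ imply $\alpha+\beta\in C$. A subset $C\subset \Phi$ is biclosed (in $\Phi$) if both $C$ and $\Phi\setminus C$ are closed. $W$ acts on biclosed sets by $C\mapsto w(C)$. A quasitrivial semigroup structure on a set $X$ is an associative map $F:X\times X\to X$ with $F(a,b)\in\{a,b\}$ for all $a,b\in X$. $W=S_{n+1}$ acts on quasitrivial semigroup structures on $X_{n+1}$ by $(\sigma F)(a,b)=\sigma(F(\sigma^{-1}(a),\sigma^{-1}(b)))$. *)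

theory Defs
  imports Complex_Main "HOL-Library.FuncSet" "HOL-Combinatorics.Permutations"
begin

text \<open>The simple roots are a family \<open>\<alpha>\<close> indexed by \<open>{1..n}\<close>; its values outside this range are irrelevant.\<close>

definition roots_A :: "nat \<Rightarrow> (nat \<Rightarrow> 'v::real_vector) \<Rightarrow> 'v set" where
  "roots_A n \<alpha> = {v. \<exists>i k. 1 \<le> i \<and> i \<le> k \<and> k \<le> n \<and>
                     (v = (\<Sum>m=i..k. \<alpha> m) \<or> v = - (\<Sum>m=i..k. \<alpha> m))}"

text \<open>\<open>root_A \<alpha> a b\<close> is \<open>\<alpha>\<^sub>a\<^sub>,\<^sub>b\<close>; it is only meaningful for \<open>a \<noteq> b\<close> in \<open>{1..n+1}\<close>
  (the value at \<open>a = b\<close> is 0).\<close>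

definition root_A :: "(nat \<Rightarrow> 'v::real_vector) \<Rightarrow> nat \<Rightarrow> nat \<Rightarrow> 'v" where
  "root_A \<alpha> a b = (if a < b then (\<Sum>m=a..<b. \<alpha> m) else - (\<Sum>m=b..<a. \<alpha> m))"

definition closed_in_roots :: "'v::real_vector set \<Rightarrow> 'v set \<Rightarrow> bool" where
  "closed_in_roots \<Phi> C \<longleftrightarrow> (\<forall>\<beta>\<in>C. \<forall>\<gamma>\<in>C. \<beta> + \<gamma> \<in> \<Phi> \<longrightarrow> \<beta> + \<gamma> \<in> C)"

definition biclosed_sets :: "'v::real_vector set \<Rightarrow> 'v set set" where
  "biclosed_sets \<Phi> = {C. C \<subseteq> \<Phi> \<and> closed_in_roots \<Phi> C \<and> closed_in_roots \<Phi> (\<Phi> - C)}"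

text \<open>The action of a permutation \<open>w\<close> of \<open>{1..n+1}\<close> on a root. The description determines a unique
  value on roots when \<open>\<alpha>\<^sub>1, \<dots>, \<alpha>\<^sub>n\<close> are linearly independent; see \<open>act_root_root_A\<close>.\<close>

definition act_root :: "nat \<Rightarrow> (nat \<Rightarrow> 'v::real_vector) \<Rightarrow> (nat \<Rightarrow> nat) \<Rightarrow> 'v \<Rightarrow> 'v" where
  "act_root n \<alpha> w \<beta> = (THE \<gamma>. \<exists>a\<in>{1..n+1}. \<exists>b\<in>{1..n+1}.
      a \<noteq> b \<and> \<beta> = root_A \<alpha> a b \<and> \<gamma> = root_A \<alpha> (w a) (w b))"

text \<open>Operations on \<open>X\<close> are extensional functions, so that equality of operations is equality on \<open>X \<times> X\<close>.\<close>

definition quasitrivial_semigroups :: "'a set \<Rightarrow> ('a \<times> 'a \<Rightarrow> 'a) set" where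
  "quasitrivial_semigroups X = {F \<in> (X \<times> X) \<rightarrow>\<^sub>E X.
     (\<forall>a\<in>X. \<forall>b\<in>X. \<forall>c\<in>X. F (F (a, b), c) = F (a, F (b, c))) \<and>
     (\<forall>a\<in>X. \<forall>b\<in>X. F (a, b) \<in> {a, b})}"

definition act_op :: "'a set \<Rightarrow> ('a \<Rightarrow> 'a) \<Rightarrow> ('a \<times> 'a \<Rightarrow> 'a) \<Rightarrow> ('a \<times> 'a \<Rightarrow> 'a)" where
  "act_op X \<sigma> F = restrict (\<lambda>(a, b). \<sigma> (F (inv \<sigma> a, inv \<sigma> b))) (X \<times> X)"

lemma root_A_coeff:
  assumes "a \<in> {1..n+1}" "b \<in> {1..n+1}"
  shows "root_A \<alpha> a b = (\<Sum>i=1..n. (of_bool (a \<le> i \<and> i < b) - of_bool (b \<le> i \<and> i < a)) *\<^sub>R \<alpha> i)"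
proof -
  have *: "(\<Sum>m=c..<d. \<alpha> m) = (\<Sum>i=1..n. of_bool (c \<le> i \<and> i < d) *\<^sub>R \<alpha> i)"
    if "c \<in> {1..n+1}" "d \<in> {1..n+1}" for c d
  proof -
    have "(\<Sum>i=1..n. of_bool (c \<le> i \<and> i < d) *\<^sub>R \<alpha> i) = (\<Sum>i\<in>{c..<d}. of_bool (c \<le> i \<and> i < d) *\<^sub>R \<alpha> i)"
      using that by (intro sum.mono_neutral_right) auto
    also have "\<dots> = (\<Sum>m=c..<d. \<alpha> m)" by (intro sum.cong) auto
    finally show ?thesis by simp
  qed
  show ?thesis
  proof (cases "a < b")
    case True
    then have "(\<Sum>m=b..<a. \<alpha> m) = 0" by simp
    then have "root_A \<alpha> a b = (\<Sum>m=a..<b. \<alpha> m) - (\<Sum>m=b..<a. \<alpha> m)"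
      using True by (simp add: root_A_def)
    then show ?thesis
      using *[OF assms] *[OF assms(2,1)] by (simp add: sum_subtractf scaleR_diff_left)
  next
    case False
    then have "root_A \<alpha> a b = (\<Sum>m=a..<b. \<alpha> m) - (\<Sum>m=b..<a. \<alpha> m)"
      by (simp add: root_A_def)
    then show ?thesis
      using *[OF assms] *[OF assms(2,1)] by (simp add: sum_subtractf scaleR_diff_left)
  qed
qed

lemma root_A_inject:
  fixes \<alpha> :: "nat \<Rightarrow> 'v::real_vector"
  assumes inj: "inj_on \<alpha> {1..n}" and ind: "independent (\<alpha> ` {1..n})"
    and ab: "a \<in> {1..n+1}" "b \<in> {1..n+1}" "a \<noteq> b"
    and cd: "c \<in> {1..n+1}" "d \<in> {1..n+1}" "c \<noteq> d"
    and eq: "root_A \<alpha> a b = root_A \<alpha> c d"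
  shows "a = c \<and> b = d"
proof -
  define k :: "nat \<Rightarrow> nat \<Rightarrow> nat \<Rightarrow> real"
    where "k x y i = of_bool (x \<le> i \<and> i < y) - of_bool (y \<le> i \<and> i < x)" for x y i
  have "(\<Sum>i=1..n. (k a b i - k c d i) *\<^sub>R \<alpha> i) = 0"
    using eq root_A_coeff[OF ab(1,2), of \<alpha>] root_A_coeff[OF cd(1,2), of \<alpha>]
    by (simp add: k_def scaleR_diff_left sum_subtractf)
  then have z: "(\<Sum>v\<in>\<alpha> ` {1..n}. (k a b (inv_into {1..n} \<alpha> v) - k c d (inv_into {1..n} \<alpha> v)) *\<^sub>R v) = 0"
    using inj by (simp add: sum.reindex)
  have k: "k a b i = k c d i" if i: "i \<in> {1..n}" for i
  proof -
    have "k a b (inv_into {1..n} \<alpha> (\<alpha> i)) - k c d (inv_into {1..n} \<alpha> (\<alpha> i)) = 0"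
      using ind z i by (intro independentD[where s = "\<alpha> ` {1..n}" and t = "\<alpha> ` {1..n}" and
        u = "\<lambda>v. k a b (inv_into {1..n} \<alpha> v) - k c d (inv_into {1..n} \<alpha> v)"]) auto
    then show ?thesis using inj i by simp
  qed
  have iff: "(a \<le> i \<and> i < b \<longleftrightarrow> c \<le> i \<and> i < d) \<and> (b \<le> i \<and> i < a \<longleftrightarrow> d \<le> i \<and> i < c)"
    if "i \<in> {1..n}" for i
    using k[OF that] by (auto simp: k_def of_bool_def split: if_splits)
  have r: "x = x' \<and> y = y'"
    if "x < y" "x \<in> {1..n+1}" "y \<in> {1..n+1}" "x' \<in> {1..n+1}" "y' \<in> {1..n+1}"
      and h: "\<And>i. i \<in> {1..n} \<Longrightarrow> x \<le> i \<and> i < y \<longleftrightarrow> x' \<le> i \<and> i < y'" for x y x' y'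
  proof -
    have "{x..<y} = {x'..<y'}"
    proof (intro set_eqI iffI)
      fix i
      show "i \<in> {x'..<y'}" if "i \<in> {x..<y}"
        using that h[of i] \<open>x \<in> _\<close> \<open>y \<in> _\<close> by auto
      show "i \<in> {x..<y}" if "i \<in> {x'..<y'}"
        using that h[of i] \<open>x' \<in> _\<close> \<open>y' \<in> _\<close> by auto
    qed
    then show ?thesis using \<open>x < y\<close> by (metis atLeastLessThan_eq_iff atLeastLessThan_empty_iff not_le order.strict_iff_not)
  qed
  show ?thesis
  proof (cases "a < b")
    case True
    then show ?thesis using r[of a b c d] ab cd iff by blast
  next
    case False
    then show ?thesis using r[of b a d c] ab cd iff by (metis linorder_neqE_nat)
  qed
qed

lemma act_root_root_A:
  fixes \<alpha> :: "nat \<Rightarrow> 'v::real_vector"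
  assumes "inj_on \<alpha> {1..n}" "independent (\<alpha> ` {1..n})"
    and "a \<in> {1..n+1}" "b \<in> {1..n+1}" "a \<noteq> b"
  shows "act_root n \<alpha> w (root_A \<alpha> a b) = root_A \<alpha> (w a) (w b)"
  unfolding act_root_def
proof (rule the_equality)
  show "\<exists>a'\<in>{1..n+1}. \<exists>b'\<in>{1..n+1}. a' \<noteq> b' \<and> root_A \<alpha> a b = root_A \<alpha> a' b' \<and>
      root_A \<alpha> (w a) (w b) = root_A \<alpha> (w a') (w b')"
    using assms(3-5) by blast
next
  fix \<gamma>
  assume "\<exists>a'\<in>{1..n+1}. \<exists>b'\<in>{1..n+1}. a' \<noteq> b' \<and> root_A \<alpha> a b = root_A \<alpha> a' b' \<and>
      \<gamma> = root_A \<alpha> (w a') (w b')"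
  then obtain a' b' where "a' \<in> {1..n+1}" "b' \<in> {1..n+1}" "a' \<noteq> b'"
      "root_A \<alpha> a b = root_A \<alpha> a' b'" "\<gamma> = root_A \<alpha> (w a') (w b')" by blast
  then show "\<gamma> = root_A \<alpha> (w a) (w b)"
    using root_A_inject[OF assms, of a' b'] by simp
qed

lemma roots_A_eq: "roots_A n \<alpha> = {root_A \<alpha> a b | a b. a \<in> {1..n+1} \<and> b \<in> {1..n+1} \<and> a \<noteq> b}"
proof (intro set_eqI iffI)
  fix v assume "v \<in> roots_A n \<alpha>"
  then obtain i k where ik: "1 \<le> i" "i \<le> k" "k \<le> n"
    and v: "v = (\<Sum>m=i..k. \<alpha> m) \<or> v = - (\<Sum>m=i..k. \<alpha> m)"
    by (auto simp: roots_A_def)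
  have "v = root_A \<alpha> i (k+1) \<or> v = root_A \<alpha> (k+1) i"
    using v ik by (auto simp: root_A_def atLeastLessThanSuc_atLeastAtMost)
  moreover have "i \<in> {1..n+1}" "k+1 \<in> {1..n+1}" "i \<noteq> k+1" using ik by auto
  ultimately show "v \<in> {root_A \<alpha> a b | a b. a \<in> {1..n+1} \<and> b \<in> {1..n+1} \<and> a \<noteq> b}" by blast
next
  fix v assume "v \<in> {root_A \<alpha> a b | a b. a \<in> {1..n+1} \<and> b \<in> {1..n+1} \<and> a \<noteq> b}"
  then obtain a b where ab: "a \<in> {1..n+1}" "b \<in> {1..n+1}" "a \<noteq> b" and v: "v = root_A \<alpha> a b" by blast
  have s: "\<exists>i k. 1 \<le> i \<and> i \<le> k \<and> k \<le> n \<and> (\<Sum>m=c..<d. \<alpha> m) = (\<Sum>m=i..k. \<alpha> m)"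
    if "c < d" "c \<in> {1..n+1}" "d \<in> {1..n+1}" for c d
    using that by (intro exI[of _ c] exI[of _ "d - 1"])
      (auto simp: atLeastLessThanSuc_atLeastAtMost[symmetric])
  show "v \<in> roots_A n \<alpha>"
  proof (cases "a < b")
    case True
    then show ?thesis using s[of a b] ab v by (auto simp: roots_A_def root_A_def)
  next
    case False
    then show ?thesis using s[of b a] ab v by (fastforce simp: roots_A_def root_A_def)
  qed
qed

end

(* Identify C with the relation "alpha_{a,b} is in C" on distinct indices: C is biclosed iff this
   relation and its complement are both transitive on triples of distinct elements. The operation
   with F(a,b) = a if alpha_{a,b} is in C and F(a,b) = b otherwise is quasitrivial, and comparing
   F(F(a,b),c) with F(a,F(b,c)) shows that its associativity is exactly this pair of transitivity
   conditions. *)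
theory Submission
  imports Defs
begin

section \<open>Sums of roots, and biclosedness in terms of indices\<close>

lemma root_A_add: "root_A \<alpha> a b + root_A \<alpha> b c = root_A \<alpha> a c"
proof -
  \<comment> \<open>Every \<open>root_A \<alpha> x y\<close> is the difference of one potential at y
    and at x, whatever the order of x and y, so consecutive ones telescope.\<close>
  have e: "root_A \<alpha> x y = sum \<alpha> {..<y} - sum \<alpha> {..<x}" for x y
  proof -
    have *: "sum \<alpha> {u..<v} = sum \<alpha> {..<v} - sum \<alpha> {..<u}" if "u \<le> v" for u v
      using sum_diff_nat_ivl[of 0 u v \<alpha>] that by (simp add: atLeast0LessThan)
    show ?thesis using *[of x y] *[of y x] by (simp add: root_A_def)
  qed
  show ?thesis unfolding e by simp
qed

text \<open>Think of \<open>root_A \<alpha> x y\<close> as e_y - e_x. If neither b = c nor d = a,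
  then neither -e_a nor -e_c cancels on the left, so the negative coefficients there add up to -2,
  whereas e_f - e_e offers only a single -1.\<close>

lemma root_A_sum_eq_root_A:
  fixes \<alpha> :: "nat \<Rightarrow> 'v::real_vector"
  assumes inj: "inj_on \<alpha> {1..n}" and ind: "independent (\<alpha> ` {1..n})"
    and X: "{a, b, c, d, e, f} \<subseteq> {1..n+1}"
    and ne: "a \<noteq> b" "c \<noteq> d" "e \<noteq> f"
    and eq: "root_A \<alpha> a b + root_A \<alpha> c d = root_A \<alpha> e f"
  shows "b = c \<or> d = a"
proof -
  define D :: "nat \<Rightarrow> nat \<Rightarrow> real" where "D k x = of_bool (x = k)" for k x
  \<comment> \<open>A functional reading off the \<open>k\<close>-th coordinate when \<open>\<alpha>\<^sub>x\<^sub>,\<^sub>y\<close> is realised as \<open>e\<^sub>y - e\<^sub>x\<close>.\<close>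
  have functional: "\<exists>\<phi>. linear \<phi> \<and> (\<forall>x\<in>{1..n+1}. \<forall>y\<in>{1..n+1}. \<phi> (root_A \<alpha> x y) = D k y - D k x)" for k
  proof -
    \<comment> \<open>By independence the values on the simple roots may be prescribed; \<alpha>_i
      receives the k-th coordinate of e_(i+1) - e_i, and \<open>inv_into\<close> recovers the index
      i from the vector.\<close>
    obtain \<phi> :: "'v \<Rightarrow> real" where lin: "linear \<phi>"
      and \<phi>: "\<forall>v\<in>\<alpha> ` {1..n}. \<phi> v = D k (Suc (inv_into {1..n} \<alpha> v)) - D k (inv_into {1..n} \<alpha> v)"
      using linear_independent_extend[OF ind, where
        f = "\<lambda>v. D k (Suc (inv_into {1..n} \<alpha> v)) - D k (inv_into {1..n} \<alpha> v)"] by auto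
    have s: "\<phi> (sum \<alpha> {x..<y}) = D k y - D k x"
      if "x \<le> y" "x \<in> {1..n+1}" "y \<in> {1..n+1}" for x y
    proof -
      have "\<phi> (sum \<alpha> {x..<y}) = (\<Sum>i=x..<y. \<phi> (\<alpha> i))" by (rule linear_sum[OF lin])
      also have "\<dots> = (\<Sum>i=x..<y. D k (Suc i) - D k i)"
        using that inj \<phi> by (intro sum.cong) auto
      also have "\<dots> = D k y - D k x" by (rule sum_Suc_diff'[OF that(1)])
      finally show ?thesis .
    qed
    show ?thesis using s lin by (intro exI[of _ \<phi>]) (auto simp: root_A_def linear_neg)
  qed
  have "D k b - D k a + (D k d - D k c) = D k f - D k e" for k
  proof -
    obtain \<phi> where \<phi>: "\<And>x y. x \<in> {1..n+1} \<Longrightarrow> y \<in> {1..n+1} \<Longrightarrow> \<phi> (root_A \<alpha> x y) = D k y - D k x"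
      and lin: "linear \<phi>"
      using functional by blast
    have "\<phi> (root_A \<alpha> a b) + \<phi> (root_A \<alpha> c d) = \<phi> (root_A \<alpha> e f)"
      using eq linear_add[OF lin] by metis
    then show ?thesis using X by (simp add: \<phi> del: atLeastAtMost_iff)
  qed
  \<comment> \<open>Coordinates of the indices that carry a minus sign: if no cancellation occurred,
    those at a and c would force a = e = c, and then the left side would be -2 there.\<close>
  from this[of e] this[of c] this[of a] show ?thesis
    using ne by (auto simp: D_def of_bool_def split: if_splits)
qed

text \<open>Two roots add up to a root only when they can be chained as
  \<open>root_A \<alpha> a b\<close> and \<open>root_A \<alpha> b c\<close>. The outer indices are
  then distinct, since opposite roots sum to 0, which is not a root.\<close>

lemma closed_in_roots_iff:
  fixes \<alpha> :: "nat \<Rightarrow> 'v::real_vector"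
  assumes inj: "inj_on \<alpha> {1..n}" and ind: "independent (\<alpha> ` {1..n})"
    and C: "C \<subseteq> roots_A n \<alpha>"
  shows "closed_in_roots (roots_A n \<alpha>) C \<longleftrightarrow>
    (\<forall>a\<in>{1..n+1}. \<forall>b\<in>{1..n+1}. \<forall>c\<in>{1..n+1}. a \<noteq> b \<longrightarrow> b \<noteq> c \<longrightarrow> a \<noteq> c \<longrightarrow>
      root_A \<alpha> a b \<in> C \<longrightarrow> root_A \<alpha> b c \<in> C \<longrightarrow> root_A \<alpha> a c \<in> C)" (is "?L \<longleftrightarrow> ?R")
proof
  assume L: ?L
  show ?R
  proof (intro ballI impI)
    fix a b c
    assume "a \<in> {1..n+1}" "c \<in> {1..n+1}" "a \<noteq> c" "root_A \<alpha> a b \<in> C" "root_A \<alpha> b c \<in> C"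
    moreover from this have "root_A \<alpha> a c \<in> roots_A n \<alpha>" unfolding roots_A_eq by blast
    ultimately show "root_A \<alpha> a c \<in> C"
      using L root_A_add[of \<alpha> a b c] unfolding closed_in_roots_def by metis
  qed
next
  assume R: ?R
  show ?L unfolding closed_in_roots_def
  proof (intro ballI impI)
    fix \<beta> \<gamma> assume C': "\<beta> \<in> C" "\<gamma> \<in> C" and \<beta>\<gamma>: "\<beta> + \<gamma> \<in> roots_A n \<alpha>"
    have root: "\<exists>x y. v = root_A \<alpha> x y \<and> x \<in> {1..n+1} \<and> y \<in> {1..n+1} \<and> x \<noteq> y"
      if "v \<in> roots_A n \<alpha>" for v
      using that unfolding roots_A_eq by (rule CollectD)
    obtain a b where \<beta>: "\<beta> = root_A \<alpha> a b" and ab: "a \<in> {1..n+1}" "b \<in> {1..n+1}" "a \<noteq> b"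
      using root[OF subsetD[OF C C'(1)]] by metis
    obtain c d where \<gamma>: "\<gamma> = root_A \<alpha> c d" and cd: "c \<in> {1..n+1}" "d \<in> {1..n+1}" "c \<noteq> d"
      using root[OF subsetD[OF C C'(2)]] by metis
    obtain e f where sum: "\<beta> + \<gamma> = root_A \<alpha> e f" and ef: "e \<in> {1..n+1}" "f \<in> {1..n+1}" "e \<noteq> f"
      using root[OF \<beta>\<gamma>] by metis
    \<comment> \<open>A zero root would coincide with its own opposite, against the injectivity of
      \<open>root_A\<close> on pairs of distinct indices.\<close>
    have nz: "\<beta> + \<gamma> \<noteq> 0"
    proof
      assume "\<beta> + \<gamma> = 0"
      then have "root_A \<alpha> e f = root_A \<alpha> f e"
        using root_A_add[of \<alpha> e f e] sum by (simp add: root_A_def)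
      then show False using root_A_inject[OF inj ind ef ef(2,1)] ef(3) by simp
    qed
    have "b = c \<or> d = a"
    proof (rule root_A_sum_eq_root_A[OF inj ind _ ab(3) cd(3) ef(3)])
      show "{a, b, c, d, e, f} \<subseteq> {1..n+1}" using ab cd ef by simp
      show "root_A \<alpha> a b + root_A \<alpha> c d = root_A \<alpha> e f" using sum \<beta> \<gamma> by simp
    qed
    then show "\<beta> + \<gamma> \<in> C"
    proof
      assume "b = c"
      moreover from this have "\<beta> + \<gamma> = root_A \<alpha> a d" using \<beta> \<gamma> root_A_add by metis
      moreover from this nz have "a \<noteq> d" by (auto simp: root_A_def)
      ultimately show ?thesis using R ab cd C' \<beta> \<gamma> by metis
    next
      assume "d = a"
      moreover from this have "\<beta> + \<gamma> = root_A \<alpha> c b" using \<beta> \<gamma> root_A_add add.commute by metis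
      moreover from this nz have "c \<noteq> b" by (auto simp: root_A_def)
      ultimately show ?thesis using R ab cd C' \<beta> \<gamma> by metis
    qed
  qed
qed

lemma biclosed_sets_iff:
  fixes \<alpha> :: "nat \<Rightarrow> 'v::real_vector"
  assumes inj: "inj_on \<alpha> {1..n}" and ind: "independent (\<alpha> ` {1..n})"
  shows "C \<in> biclosed_sets (roots_A n \<alpha>) \<longleftrightarrow> C \<subseteq> roots_A n \<alpha> \<and>
    (\<forall>a\<in>{1..n+1}. \<forall>b\<in>{1..n+1}. \<forall>c\<in>{1..n+1}. a \<noteq> b \<longrightarrow> b \<noteq> c \<longrightarrow> a \<noteq> c \<longrightarrow>
      (root_A \<alpha> a b \<in> C \<longrightarrow> root_A \<alpha> b c \<in> C \<longrightarrow> root_A \<alpha> a c \<in> C) \<and>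
      (root_A \<alpha> a b \<notin> C \<longrightarrow> root_A \<alpha> b c \<notin> C \<longrightarrow> root_A \<alpha> a c \<notin> C))"
proof -
  \<comment> \<open>For distinct indices the vector is always a root, so the complement inside the
    root system becomes plain non-membership.\<close>
  have compl: "root_A \<alpha> a b \<in> roots_A n \<alpha> - C \<longleftrightarrow> root_A \<alpha> a b \<notin> C"
    if "a \<in> {1..n+1}" "b \<in> {1..n+1}" "a \<noteq> b" for a b
    using that unfolding roots_A_eq by blast
  have "closed_in_roots (roots_A n \<alpha>) (roots_A n \<alpha> - C) \<longleftrightarrow>
    (\<forall>a\<in>{1..n+1}. \<forall>b\<in>{1..n+1}. \<forall>c\<in>{1..n+1}. a \<noteq> b \<longrightarrow> b \<noteq> c \<longrightarrow> a \<noteq> c \<longrightarrow>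
      root_A \<alpha> a b \<notin> C \<longrightarrow> root_A \<alpha> b c \<notin> C \<longrightarrow> root_A \<alpha> a c \<notin> C)"
    unfolding closed_in_roots_iff[OF inj ind Diff_subset]
  proof (intro ball_cong refl, goal_cases)
    case (1 a b c)
    then show ?case using compl[of a b] compl[of b c] compl[of a c] by blast
  qed
  then show ?thesis
    unfolding biclosed_sets_def mem_Collect_eq
    using closed_in_roots_iff[OF inj ind, of C] by blast
qed

section \<open>The two mutually inverse maps\<close>

definition op_of_roots :: "nat \<Rightarrow> (nat \<Rightarrow> 'v::real_vector) \<Rightarrow> 'v set \<Rightarrow> nat \<times> nat \<Rightarrow> nat" where
  "op_of_roots n \<alpha> C =
    restrict (\<lambda>(a, b). if root_A \<alpha> a b \<in> C then a else b) ({1..n+1} \<times> {1..n+1})"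

text \<open>Since F(a,a) = a for every quasitrivial F, the condition a \<noteq> b is what keeps the
  zero vector out.\<close>

definition roots_of_op :: "nat \<Rightarrow> (nat \<Rightarrow> 'v::real_vector) \<Rightarrow> (nat \<times> nat \<Rightarrow> nat) \<Rightarrow> 'v set" where
  "roots_of_op n \<alpha> F =
    {root_A \<alpha> a b | a b. a \<in> {1..n+1} \<and> b \<in> {1..n+1} \<and> a \<noteq> b \<and> F (a, b) = a}"

lemma op_of_roots_apply:
  assumes "a \<in> {1..n+1}" "b \<in> {1..n+1}"
  shows "op_of_roots n \<alpha> C (a, b) = (if root_A \<alpha> a b \<in> C then a else b)"
  using assms by (simp add: op_of_roots_def)

lemma root_A_in_roots_of_op:
  assumes "inj_on \<alpha> {1..n}" "independent (\<alpha> ` {1..n})"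
    and "a \<in> {1..n+1}" "b \<in> {1..n+1}" "a \<noteq> b"
  shows "root_A \<alpha> a b \<in> roots_of_op n \<alpha> F \<longleftrightarrow> F (a, b) = a"
  using root_A_inject[OF assms] assms(3-5) unfolding roots_of_op_def by blast

lemma op_of_roots_quasitrivial:
  fixes \<alpha> :: "nat \<Rightarrow> 'v::real_vector"
  assumes inj: "inj_on \<alpha> {1..n}" and ind: "independent (\<alpha> ` {1..n})"
    and C: "C \<in> biclosed_sets (roots_A n \<alpha>)"
  shows "op_of_roots n \<alpha> C \<in> quasitrivial_semigroups {1..n+1}"
proof -
  let ?F = "op_of_roots n \<alpha> C"
  have assoc: "?F (?F (a, b), c) = ?F (a, ?F (b, c))"
    if X: "a \<in> {1..n+1}" "b \<in> {1..n+1}" "c \<in> {1..n+1}" for a b c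
  proof -
    have "(root_A \<alpha> a b \<in> C \<longrightarrow> root_A \<alpha> b c \<in> C \<longrightarrow> root_A \<alpha> a c \<in> C) \<and>
      (root_A \<alpha> a b \<notin> C \<longrightarrow> root_A \<alpha> b c \<notin> C \<longrightarrow> root_A \<alpha> a c \<notin> C)"
      if "a \<noteq> b" "b \<noteq> c" "a \<noteq> c"
      using that X C unfolding biclosed_sets_iff[OF inj ind] by blast
    moreover have "?F (?F (a, b), c) =
      (if root_A \<alpha> a b \<in> C then if root_A \<alpha> a c \<in> C then a else c
       else if root_A \<alpha> b c \<in> C then b else c)"
      using X by (simp add: op_of_roots_apply)
    moreover have "?F (a, ?F (b, c)) =
      (if root_A \<alpha> b c \<in> C then if root_A \<alpha> a b \<in> C then a else b
       else if root_A \<alpha> a c \<in> C then a else c)"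
      using X by (simp add: op_of_roots_apply)
    \<comment> \<open>If exactly one of the roots for (a,b) and (b,c) lies in C, the two products
      agree outright. If both or neither do, they agree precisely when the root for (a,c) follows
      suit. Triples with a repetition are settled by the same case split, without
      biclosedness.\<close>
    ultimately show ?thesis by (metis (full_types))
  qed
  have "?F \<in> ({1..n+1} \<times> {1..n+1}) \<rightarrow>\<^sub>E {1..n+1}"
    by (auto simp: op_of_roots_def)
  with assoc show ?thesis
    unfolding quasitrivial_semigroups_def by (simp add: op_of_roots_apply)
qed

lemma roots_of_op_biclosed:
  fixes \<alpha> :: "nat \<Rightarrow> 'v::real_vector"
  assumes inj: "inj_on \<alpha> {1..n}" and ind: "independent (\<alpha> ` {1..n})"
    and F: "F \<in> quasitrivial_semigroups {1..n+1}"
  shows "roots_of_op n \<alpha> F \<in> biclosed_sets (roots_A n \<alpha>)"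
  unfolding biclosed_sets_iff[OF inj ind]
proof (intro conjI ballI impI)
  show "roots_of_op n \<alpha> F \<subseteq> roots_A n \<alpha>"
    unfolding roots_of_op_def roots_A_eq by blast
next
  fix a b c
  assume X: "a \<in> {1..n+1}" "b \<in> {1..n+1}" "c \<in> {1..n+1}" and ne: "a \<noteq> b" "b \<noteq> c" "a \<noteq> c"
  have assoc: "F (F (a, b), c) = F (a, F (b, c))"
    and q: "F (a, b) \<in> {a, b}" "F (b, c) \<in> {b, c}"
    using F X by (auto simp: quasitrivial_semigroups_def)
  note m = root_A_in_roots_of_op[OF inj ind]
  {
    assume "root_A \<alpha> a b \<in> roots_of_op n \<alpha> F" "root_A \<alpha> b c \<in> roots_of_op n \<alpha> F"
    \<comment> \<open>F(a,c) = F(F(a,b),c) = F(a,F(b,c)) = F(a,b) = a.\<close>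
    then show "root_A \<alpha> a c \<in> roots_of_op n \<alpha> F"
      using assoc m X ne by metis
  next
    assume "root_A \<alpha> a b \<notin> roots_of_op n \<alpha> F" "root_A \<alpha> b c \<notin> roots_of_op n \<alpha> F"
    then have "F (a, b) = b" "F (b, c) = c" using q m X ne by auto
    \<comment> \<open>F(a,c) = F(a,F(b,c)) = F(F(a,b),c) = F(b,c) = c, which differs from a.\<close>
    then show "root_A \<alpha> a c \<notin> roots_of_op n \<alpha> F"
      using assoc m X ne by metis
  }
qed

lemma bij_betw_op_of_roots:
  fixes \<alpha> :: "nat \<Rightarrow> 'v::real_vector"
  assumes inj: "inj_on \<alpha> {1..n}" and ind: "independent (\<alpha> ` {1..n})"
  shows "bij_betw (op_of_roots n \<alpha>) (biclosed_sets (roots_A n \<alpha>)) (quasitrivial_semigroups {1..n+1})"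
proof (rule bij_betw_byWitness[where f' = "roots_of_op n \<alpha>"])
  note m = root_A_in_roots_of_op[OF inj ind]
  show "\<forall>C\<in>biclosed_sets (roots_A n \<alpha>). roots_of_op n \<alpha> (op_of_roots n \<alpha> C) = C"
  proof (intro ballI set_eqI)
    fix C v assume "C \<in> biclosed_sets (roots_A n \<alpha>)"
    then have C: "C \<subseteq> roots_A n \<alpha>" by (simp add: biclosed_sets_def)
    have "roots_of_op n \<alpha> (op_of_roots n \<alpha> C) \<subseteq> roots_A n \<alpha>"
      unfolding roots_of_op_def roots_A_eq by blast
    moreover have "v \<in> roots_of_op n \<alpha> (op_of_roots n \<alpha> C) \<longleftrightarrow> v \<in> C" if "v \<in> roots_A n \<alpha>"
      using that m unfolding roots_A_eq by (auto simp: op_of_roots_apply split: if_splits)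
    ultimately show "v \<in> roots_of_op n \<alpha> (op_of_roots n \<alpha> C) \<longleftrightarrow> v \<in> C" using C by blast
  qed
  show "\<forall>F\<in>quasitrivial_semigroups {1..n+1}. op_of_roots n \<alpha> (roots_of_op n \<alpha> F) = F"
  proof
    fix F assume F: "F \<in> quasitrivial_semigroups {1..n+1}"
    then have "F \<in> extensional ({1..n+1} \<times> {1..n+1})"
      by (auto simp: quasitrivial_semigroups_def PiE_def)
    moreover have "op_of_roots n \<alpha> (roots_of_op n \<alpha> F) p = F p" if pX: "p \<in> {1..n+1} \<times> {1..n+1}" for p
    proof -
      obtain a b where p: "p = (a, b)" "a \<in> {1..n+1}" "b \<in> {1..n+1}" using pX by blast
      then have "F (a, b) \<in> {a, b}" using F by (simp add: quasitrivial_semigroups_def)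
      then show ?thesis
        \<comment> \<open>On the diagonal both sides are a, by quasitriviality and because the two
          branches of \<open>op_of_roots\<close> coincide; off it, F(a,b) \<noteq> a means F(a,b) =
          b.\<close>
        using p m[of a b F] by (cases "a = b") (auto simp: op_of_roots_apply)
    qed
    ultimately show "op_of_roots n \<alpha> (roots_of_op n \<alpha> F) = F"
      by (intro extensionalityI[of _ "{1..n+1} \<times> {1..n+1}"]) (simp_all add: op_of_roots_def)
  qed
qed (use op_of_roots_quasitrivial[OF inj ind] roots_of_op_biclosed[OF inj ind] in blast)+

section \<open>Equivariance\<close>

text \<open>Pulls membership in w(C) back along the inverse of w, the form in which
  \<open>act_op\<close> evaluates an operation. Left to right, injectivity of \<open>root_A\<close>
  identifies a and b as the images under w of the indices of a root in C; right to left, that root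
  is the preimage.\<close>

lemma root_A_in_act_root_image:
  fixes \<alpha> :: "nat \<Rightarrow> 'v::real_vector"
  assumes inj: "inj_on \<alpha> {1..n}" and ind: "independent (\<alpha> ` {1..n})"
    and w: "w permutes {1..n+1}" and C: "C \<subseteq> roots_A n \<alpha>"
    and ab: "a \<in> {1..n+1}" "b \<in> {1..n+1}" "a \<noteq> b"
  shows "root_A \<alpha> a b \<in> act_root n \<alpha> w ` C \<longleftrightarrow> root_A \<alpha> (inv w a) (inv w b) \<in> C"
proof
  note act = act_root_root_A[OF inj ind]
  assume "root_A \<alpha> a b \<in> act_root n \<alpha> w ` C"
  then obtain c d where cd: "c \<in> {1..n+1}" "d \<in> {1..n+1}" "c \<noteq> d" "root_A \<alpha> c d \<in> C"
    and "root_A \<alpha> a b = act_root n \<alpha> w (root_A \<alpha> c d)"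
    using C unfolding roots_A_eq by blast
  then have "root_A \<alpha> a b = root_A \<alpha> (w c) (w d)" using act by simp
  moreover have "w c \<in> {1..n+1}" "w d \<in> {1..n+1}" "w c \<noteq> w d"
    using cd w permutes_in_image[OF w] permutes_inj[OF w] by (auto dest: injD)
  ultimately have "a = w c \<and> b = w d" using root_A_inject[OF inj ind ab] by blast
  then show "root_A \<alpha> (inv w a) (inv w b) \<in> C" using cd permutes_inverses[OF w] by simp
next
  assume "root_A \<alpha> (inv w a) (inv w b) \<in> C"
  moreover have "act_root n \<alpha> w (root_A \<alpha> (inv w a) (inv w b)) = root_A \<alpha> a b"
  proof -
    have "inv w a \<in> {1..n+1}" "inv w b \<in> {1..n+1}" "inv w a \<noteq> inv w b"
      using ab permutes_in_image[OF permutes_inv[OF w]] permutes_inverses[OF w] by (auto, metis)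
    from act_root_root_A[OF inj ind this] show ?thesis using permutes_inverses[OF w] by simp
  qed
  ultimately show "root_A \<alpha> a b \<in> act_root n \<alpha> w ` C" by (metis imageI)
qed

lemma op_of_roots_act_root:
  fixes \<alpha> :: "nat \<Rightarrow> 'v::real_vector"
  assumes inj: "inj_on \<alpha> {1..n}" and ind: "independent (\<alpha> ` {1..n})"
    and w: "w permutes {1..n+1}" and C: "C \<subseteq> roots_A n \<alpha>"
  shows "op_of_roots n \<alpha> (act_root n \<alpha> w ` C) = act_op {1..n+1} w (op_of_roots n \<alpha> C)"
proof (rule extensionalityI[of _ "{1..n+1} \<times> {1..n+1}"])
  fix p assume "p \<in> {1..n+1} \<times> {1..n+1}"
  then obtain a b where p: "p = (a, b)" "a \<in> {1..n+1}" "b \<in> {1..n+1}" by blast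
  then have i: "inv w a \<in> {1..n+1}" "inv w b \<in> {1..n+1}"
    using permutes_in_image[OF permutes_inv[OF w]] by blast+
  have "act_op {1..n+1} w (op_of_roots n \<alpha> C) p = w (op_of_roots n \<alpha> C (inv w a, inv w b))"
    using p by (simp add: act_op_def)
  also have "\<dots> = (if root_A \<alpha> (inv w a) (inv w b) \<in> C then a else b)"
    using op_of_roots_apply[OF i, of \<alpha> C] permutes_inverses[OF w] by simp
  also have "\<dots> = op_of_roots n \<alpha> (act_root n \<alpha> w ` C) p"
    \<comment> \<open>The pullback concerns distinct indices only; for a = b both branches of the
      conditional give a.\<close>
    using p root_A_in_act_root_image[OF inj ind w C, of a b]
    by (cases "a = b") (simp_all add: op_of_roots_apply)
  finally show "op_of_roots n \<alpha> (act_root n \<alpha> w ` C) p = act_op {1..n+1} w (op_of_roots n \<alpha> C) p"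
    by simp
qed (simp_all add: op_of_roots_def act_op_def)

theorem theorem3p3:
  fixes n :: nat and \<alpha> :: "nat \<Rightarrow> 'v::real_vector" and V :: "'v set"
  assumes "n \<ge> 1"
    and "inj_on \<alpha> {1..n}" and "independent (\<alpha> ` {1..n})" and "span (\<alpha> ` {1..n}) = V"
  shows "\<exists>f. bij_betw f (biclosed_sets (roots_A n \<alpha>)) (quasitrivial_semigroups {1..n+1}) \<and>
             (\<forall>w. w permutes {1..n+1} \<longrightarrow>
                (\<forall>C \<in> biclosed_sets (roots_A n \<alpha>).
                   f (act_root n \<alpha> w ` C) = act_op {1..n+1} w (f C)))"
  \<comment> \<open>The witness is \<open>op_of_roots n \<alpha>\<close>; unfolding biclosedness
    supplies the inclusion of C in the root system that the equivariance lemma asks for.\<close>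
  using bij_betw_op_of_roots[OF assms(2,3)] op_of_roots_act_root[OF assms(2,3)]
  unfolding biclosed_sets_def by blast

end
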